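(* Let $(\phi_\theta,P(\theta))$ be a neural network with $\phi_\theta:\mathbb{R}\to\mathbb{R}$ whose parameters split as $\theta=(\theta^0,\theta^+,\theta^-)\in\Theta^0\times\Theta^+\times\Theta^-$, and suppose: (i) for $t>0$, $\phi_\theta(t)$ depends on $\theta^0,\theta^+$ but not on $\theta^-$ (write $\phi_{\theta^0,\theta^+}(t)$), and for $t<0$, $\phi_\theta(t)$ depends on $\theta^0,\theta^-$ but not on $\theta^+$ (write $\phi_{\theta^0,\theta^-}(t)$); (ii) the parameter density factorizes as $P(\theta^0,\theta^+,\theta^-)=P_0(\theta^0)\,P_+(\theta^0,\theta^+)\,P_-(\theta^0,\theta^-)$ with $P_0,P_+,P_-\ge 0$ measurable; (iii) (parameter absorption) there is a measurable bijection $\sigma:\Theta^+\to\Theta^-$ with measurable inverse, carrying the reference measure $d\theta^+$ to $d\theta^-$ (trivial Jacobian), such that, writing $\theta^{+\prime}=\sigma(\theta^+)$ and $\theta^{-\prime}=\sigma^{-1}(\theta^-)$, for all $t>0$ and all parameter values $$\phi_{\theta^0,\theta^+}(t)=\phi_{\theta^0,\theta^{+\prime}}(-t),\qquad \phi_{\theta^0,\theta^-}(-t)=\phi_{\theta^0,\theta^{-\prime}}(t),$$ $$P_+(\theta^0,\theta^{-\prime})=P_-(\theta^0,\theta^-),\qquad P_-(\theta^0,\theta^{+\prime})=P_+(\theta^0,\theta^+).$$ Then the network is reflection positive: for every $n\ge1$, all times $t_1,\dots,t_n>0$ and every bounded measurable $F:\mathbb{R}^n\to\mathbb{C}$, $$\int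 d\theta\,P(\theta)\,F\big(\phi_\theta(t_1),\dots,\phi_\theta(t_n)\big)\,\Big(F\big(\phi_\theta(-t_1),\dots,\phi_\theta(-t_n)\big)\Big)^{*}\ \ge\ 0.$$
   Context: A neural network here is a family of functions $\phi_\theta:\mathbb{R}\to\mathbb{R}$ indexed by parameters $\theta$ in a measurable space, together with a probability density $P(\theta)$ with respect to a $\sigma$-finite reference measure $d\theta$ (Lebesgue measure when there are finitely many real parameters); for each $t$ the map $\theta\mapsto\phi_\theta(t)$ is measurable. In the split setting $d\theta=d\theta^0\,d\theta^+\,d\theta^-$ is a product of $\sigma$-finite measures. $^*$ denotes complex conjugation. The inequality "$\geq 0$" means that the (a priori complex) quantity is real and non-negative. *)

theory Defs
  imports "HOL-Analysis.Analysis"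
begin

locale neural_network = sigma_finite_measure M
  for M :: "'p measure" and \<phi> :: "'p \<Rightarrow> real \<Rightarrow> real" and P :: "'p \<Rightarrow> real" +
  assumes measurable_network: "\<And>t. (\<lambda>\<theta>. \<phi> \<theta> t) \<in> borel_measurable M"
    and measurable_density: "P \<in> borel_measurable M"
    and density_nonneg: "\<And>\<theta>. \<theta> \<in> space M \<Longrightarrow> 0 \<le> P \<theta>"
    and density_total: "(\<integral>\<^sup>+\<theta>. ennreal (P \<theta>) \<partial>M) = 1"

text \<open>
  The space of \<open>n\<close>-tuples of reals is \<open>\<Pi>\<^sub>M i\<in>{..<n}. borel\<close>, so that \<open>n\<close> can be quantified inside
  the definition; its sigma-algebra is the Borel one. Times are indexed from \<open>0\<close>.
\<close>

definition bounded_observable :: "nat \<Rightarrow> ((nat \<Rightarrow> real) \<Rightarrow> complex) \<Rightarrow> bool" where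
  "bounded_observable n F \<longleftrightarrow>
     F \<in> borel_measurable (\<Pi>\<^sub>M i\<in>{..<n}. (borel :: real measure)) \<and>
     bounded (F ` space (\<Pi>\<^sub>M i\<in>{..<n}. (borel :: real measure)))"

definition reflection_integrand ::
    "('p \<Rightarrow> real \<Rightarrow> real) \<Rightarrow> ('p \<Rightarrow> real) \<Rightarrow> nat \<Rightarrow> (nat \<Rightarrow> real) \<Rightarrow> ((nat \<Rightarrow> real) \<Rightarrow> complex)
      \<Rightarrow> 'p \<Rightarrow> complex" where
  "reflection_integrand \<phi> P n t F \<theta> =
     complex_of_real (P \<theta>) * F (\<lambda>i\<in>{..<n}. \<phi> \<theta> (t i)) * cnj (F (\<lambda>i\<in>{..<n}. \<phi> \<theta> (- t i)))"

definition reflection_positive ::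
    "'p measure \<Rightarrow> ('p \<Rightarrow> real \<Rightarrow> real) \<Rightarrow> ('p \<Rightarrow> real) \<Rightarrow> bool" where
  "reflection_positive M \<phi> P \<longleftrightarrow>
     (\<forall>n\<ge>1. \<forall>t. \<forall>F. (\<forall>i<n. 0 < t i) \<longrightarrow> bounded_observable n F \<longrightarrow>
        (\<integral>\<theta>. reflection_integrand \<phi> P n t F \<theta> \<partial>M) \<in> \<real>\<^sub>\<ge>\<^sub>0)"

text \<open>
  The integral in \<open>reflection_positive\<close> never takes the default value of a non-integrable function.
\<close>

lemma (in neural_network) integrable_reflection_integrand:
  assumes "bounded_observable n F"
  shows "integrable M (reflection_integrand \<phi> P n t F)"
proof -
  let ?N = "\<Pi>\<^sub>M i\<in>{..<n}. (borel :: real measure)"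
  have F: "F \<in> borel_measurable ?N" using assms by (simp add: bounded_observable_def)
  obtain B where B: "\<And>x. x \<in> space ?N \<Longrightarrow> norm (F x) \<le> B"
    using assms by (auto simp: bounded_observable_def bounded_iff)
  have tup: "(\<lambda>\<theta>. \<lambda>i\<in>{..<n}. \<phi> \<theta> (s i)) \<in> measurable M ?N" for s
    by (intro measurable_restrict measurable_network)
  note [measurable] = measurable_density measurable_compose[OF tup F]
  have P: "integrable M P"
    by (rule integrableI_nonneg)
      (use measurable_density density_nonneg density_total in \<open>auto intro: AE_I2\<close>)
  have inN: "(\<lambda>i\<in>{..<n}. \<phi> \<theta> (s i)) \<in> space ?N" for \<theta> s
    by (simp add: space_PiM)
  have "integrable M (\<lambda>\<theta>. complex_of_real (P \<theta>) * F (\<lambda>i\<in>{..<n}. \<phi> \<theta> (t i))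
          * cnj (F (\<lambda>i\<in>{..<n}. \<phi> \<theta> (- t i))))"
  proof (rule Bochner_Integration.integrable_bound)
    show "integrable M (\<lambda>\<theta>. B * B * P \<theta>)" using P by simp
    have "(\<lambda>\<theta>. cnj (F (\<lambda>i\<in>{..<n}. \<phi> \<theta> (- t i)))) \<in> borel_measurable M"
      by (rule borel_measurable_continuous_on[OF continuous_on_cnj[OF continuous_on_id]]) measurable
    then show "(\<lambda>\<theta>. complex_of_real (P \<theta>) * F (\<lambda>i\<in>{..<n}. \<phi> \<theta> (t i))
          * cnj (F (\<lambda>i\<in>{..<n}. \<phi> \<theta> (- t i)))) \<in> borel_measurable M"
      by measurable
    have "norm (complex_of_real (P \<theta>) * F (\<lambda>i\<in>{..<n}. \<phi> \<theta> (t i))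
          * cnj (F (\<lambda>i\<in>{..<n}. \<phi> \<theta> (- t i)))) \<le> norm (B * B * P \<theta>)" for \<theta>
    proof -
      let ?a = "norm (F (\<lambda>i\<in>{..<n}. \<phi> \<theta> (t i)))" and ?b = "norm (F (\<lambda>i\<in>{..<n}. \<phi> \<theta> (- t i)))"
      have b: "?b \<le> B" by (rule B[OF inN[of \<theta> "\<lambda>i. - t i"]])
      have "?a * ?b \<le> B * B"
        by (rule mult_mono[OF B[OF inN] b]) (use b in \<open>auto intro: order_trans[OF norm_ge_zero]\<close>)
      then have "\<bar>P \<theta>\<bar> * (?a * ?b) \<le> \<bar>P \<theta>\<bar> * (B * B)" by (rule mult_left_mono) simp
      then show ?thesis by (simp add: norm_mult abs_mult mult_ac)
    qed
    then show "AE \<theta> in M. norm (complex_of_real (P \<theta>) * F (\<lambda>i\<in>{..<n}. \<phi> \<theta> (t i))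
          * cnj (F (\<lambda>i\<in>{..<n}. \<phi> \<theta> (- t i)))) \<le> norm (B * B * P \<theta>)" by simp
  qed
  then show ?thesis by (simp add: reflection_integrand_def[abs_def])
qed

end

(* For fixed theta^0 the integrand is a product of a function of theta^+ and a function of
   theta^-. The absorption map sigma turns the integral of the second factor into the complex
   conjugate of the integral of the first, so that after Fubini the integral is
   int d theta^0 P_0(theta^0) |h(theta^0)|^2. *)

theory Submission
  imports Defs
begin

text \<open>Integration commutes with \<open>Re\<close> and \<open>Im\<close>, so both parts of the
  integral are read off separately. If \<open>f\<close> is not integrable, the default value 0 of
  its integral also lies in the set of non-negative reals.\<close>

lemma integral_nonneg_Reals_AE:
  fixes f :: "'a \<Rightarrow> complex"
  assumes "AE x in M. f x \<in> \<real>\<^sub>\<ge>\<^sub>0"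
  shows "(\<integral>x. f x \<partial>M) \<in> \<real>\<^sub>\<ge>\<^sub>0"
proof (cases "integrable M f")
  case True
  have re: "AE x in M. 0 \<le> Re (f x)" and im: "AE x in M. Im (f x) = 0"
    using assms by (auto simp: complex_nonneg_Reals_iff)
  have "0 \<le> Re (\<integral>x. f x \<partial>M)"
    unfolding integral_Re[OF True, symmetric] by (rule integral_nonneg_AE[OF re])
  moreover have "Im (\<integral>x. f x \<partial>M) = 0"
    unfolding integral_Im[OF True, symmetric] by (rule integral_eq_zero_AE[OF im])
  ultimately show ?thesis by (simp add: complex_nonneg_Reals_iff)
qed (simp add: not_integrable_integral_eq)

text \<open>Fubini applies to the jointly integrable product. In the inner integral
  \<open>f x\<close> is constant in \<open>y\<close>, and a scalar of a field leaves a Bochner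
  integral even when the remaining factor is not integrable; hence only the joint integrability is
  assumed.\<close>

lemma (in pair_sigma_finite) integral_product:
  fixes f :: "'a \<Rightarrow> 'c::{real_normed_field, banach, second_countable_topology}"
  assumes "integrable (M1 \<Otimes>\<^sub>M M2) (\<lambda>(x, y). f x * g y)"
  shows "(\<integral>(x, y). f x * g y \<partial>(M1 \<Otimes>\<^sub>M M2)) = (\<integral>x. f x \<partial>M1) * (\<integral>y. g y \<partial>M2)"
  using integral_fst'[OF assms] by simp

theorem mainTheorem2:
  fixes M0 :: "'a measure" and Mp :: "'b measure" and Mm :: "'c measure"
    and \<phi> :: "'a \<times> 'b \<times> 'c \<Rightarrow> real \<Rightarrow> real" and P :: "'a \<times> 'b \<times> 'c \<Rightarrow> real"
    and \<phi>p :: "'a \<Rightarrow> 'b \<Rightarrow> real \<Rightarrow> real" and \<phi>m :: "'a \<Rightarrow> 'c \<Rightarrow> real \<Rightarrow> real"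
    and P0 :: "'a \<Rightarrow> real" and Pp :: "'a \<Rightarrow> 'b \<Rightarrow> real" and Pm :: "'a \<Rightarrow> 'c \<Rightarrow> real"
    and \<sigma> :: "'b \<Rightarrow> 'c"
  assumes "sigma_finite_measure M0" and "sigma_finite_measure Mp" and "sigma_finite_measure Mm"
    and network: "neural_network (M0 \<Otimes>\<^sub>M Mp \<Otimes>\<^sub>M Mm) \<phi> P"
    and split_pos: "\<And>a b c t. a \<in> space M0 \<Longrightarrow> b \<in> space Mp \<Longrightarrow> c \<in> space Mm \<Longrightarrow> t > 0
        \<Longrightarrow> \<phi> (a, b, c) t = \<phi>p a b t"
    and split_neg: "\<And>a b c t. a \<in> space M0 \<Longrightarrow> b \<in> space Mp \<Longrightarrow> c \<in> space Mm \<Longrightarrow> t < 0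
        \<Longrightarrow> \<phi> (a, b, c) t = \<phi>m a c t"
    and factorization: "\<And>a b c. a \<in> space M0 \<Longrightarrow> b \<in> space Mp \<Longrightarrow> c \<in> space Mm
        \<Longrightarrow> P (a, b, c) = P0 a * Pp a b * Pm a c"
    and P0_measurable: "P0 \<in> borel_measurable M0"
    and Pp_measurable: "(\<lambda>(a, b). Pp a b) \<in> borel_measurable (M0 \<Otimes>\<^sub>M Mp)"
    and Pm_measurable: "(\<lambda>(a, c). Pm a c) \<in> borel_measurable (M0 \<Otimes>\<^sub>M Mm)"
    and P0_nonneg: "\<And>a. a \<in> space M0 \<Longrightarrow> 0 \<le> P0 a"
    and Pp_nonneg: "\<And>a b. a \<in> space M0 \<Longrightarrow> b \<in> space Mp \<Longrightarrow> 0 \<le> Pp a b"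
    and Pm_nonneg: "\<And>a c. a \<in> space M0 \<Longrightarrow> c \<in> space Mm \<Longrightarrow> 0 \<le> Pm a c"
    and \<sigma>_bij: "bij_betw \<sigma> (space Mp) (space Mm)"
    and \<sigma>_measurable: "\<sigma> \<in> measurable Mp Mm"
    and \<sigma>_inv_measurable: "inv_into (space Mp) \<sigma> \<in> measurable Mm Mp"
    and \<sigma>_measure: "distr Mp Mm \<sigma> = Mm"
    and absorb_\<phi>p: "\<And>a b t. a \<in> space M0 \<Longrightarrow> b \<in> space Mp \<Longrightarrow> t > 0
        \<Longrightarrow> \<phi>p a b t = \<phi>m a (\<sigma> b) (- t)"
    and absorb_\<phi>m: "\<And>a c t. a \<in> space M0 \<Longrightarrow> c \<in> space Mm \<Longrightarrow> t > 0
        \<Longrightarrow> \<phi>m a c (- t) = \<phi>p a (inv_into (space Mp) \<sigma> c) t"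
    and absorb_Pp: "\<And>a c. a \<in> space M0 \<Longrightarrow> c \<in> space Mm
        \<Longrightarrow> Pp a (inv_into (space Mp) \<sigma> c) = Pm a c"
    and absorb_Pm: "\<And>a b. a \<in> space M0 \<Longrightarrow> b \<in> space Mp
        \<Longrightarrow> Pm a (\<sigma> b) = Pp a b"
  shows "reflection_positive (M0 \<Otimes>\<^sub>M Mp \<Otimes>\<^sub>M Mm) \<phi> P"
proof -
  interpret M0: sigma_finite_measure M0 by fact
  interpret Mp: sigma_finite_measure Mp by fact
  interpret Mm: sigma_finite_measure Mm by fact
  interpret pm: pair_sigma_finite Mp Mm ..
  interpret all: pair_sigma_finite M0 "Mp \<Otimes>\<^sub>M Mm" ..
  interpret neural_network "M0 \<Otimes>\<^sub>M Mp \<Otimes>\<^sub>M Mm" \<phi> P by (rule network)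
  have "(\<integral>\<theta>. reflection_integrand \<phi> P n t F \<theta> \<partial>(M0 \<Otimes>\<^sub>M Mp \<Otimes>\<^sub>M Mm)) \<in> \<real>\<^sub>\<ge>\<^sub>0"
    if t: "\<forall>i<n. 0 < t i" and F: "bounded_observable n F" for n t F
  proof -
    define R where "R = reflection_integrand \<phi> P n t F"
    \<comment> \<open>\<open>P0\<close> is kept out of both factors, so that \<open>H a\<close>
      composed with \<open>\<sigma>\<close> is exactly the conjugate of \<open>G a\<close>.\<close>
    define G where "G a b = complex_of_real (Pp a b) * F (\<lambda>i\<in>{..<n}. \<phi>p a b (t i))" for a b
    define H where "H a c = complex_of_real (Pm a c) * cnj (F (\<lambda>i\<in>{..<n}. \<phi>m a c (- t i)))" for a c
    have F_meas: "F \<in> borel_measurable (\<Pi>\<^sub>M i\<in>{..<n}. (borel :: real measure))"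
      using F by (simp add: bounded_observable_def)
    have R_int: "integrable (M0 \<Otimes>\<^sub>M Mp \<Otimes>\<^sub>M Mm) R"
      unfolding R_def by (rule integrable_reflection_integrand[OF F])
    have R_eq: "R (a, b, c) = complex_of_real (P0 a) * (G a b * H a c)"
      if "a \<in> space M0" "b \<in> space Mp" "c \<in> space Mm" for a b c
    proof -
      \<comment> \<open>Positivity of \<open>t i\<close> is known only for \<open>i < n\<close>. The
        restriction makes both tuples agree outside this range, and time 0, where nothing is said
        about the splitting, never occurs.\<close>
      have "(\<lambda>i\<in>{..<n}. \<phi> (a, b, c) (t i)) = (\<lambda>i\<in>{..<n}. \<phi>p a b (t i))"
        "(\<lambda>i\<in>{..<n}. \<phi> (a, b, c) (- t i)) = (\<lambda>i\<in>{..<n}. \<phi>m a c (- t i))"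
        using that t by (auto simp: split_pos split_neg intro!: restrict_ext)
      then show ?thesis
        using that by (simp add: R_def reflection_integrand_def G_def H_def factorization)
    qed
    \<comment> \<open>The change of variables along \<open>\<sigma>\<close> requires a measurable
      integrand. Measurability is given for \<open>\<phi>\<close> rather than for
      \<open>\<phi>m\<close>, so it is recovered by freezing a point \<open>b\<close> of
      \<open>Mp\<close> in \<open>\<phi>\<close>; this is why the case of an empty \<open>Mp\<close>
      is split off.\<close>
    have H_meas: "H a \<in> borel_measurable Mm" if a: "a \<in> space M0" for a
    proof (cases "space Mp = {}")
      case True
      \<comment> \<open>A bijection from the empty set has empty range, and every function on an
        empty space is measurable.\<close>
      then have "space Mm = {}" using \<sigma>_bij by (simp add: bij_betw_def)
      then show ?thesis by (simp add: measurable_def)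
    next
      case False
      then obtain b where b: "b \<in> space Mp" by blast
      have [measurable]: "(\<lambda>c. \<phi>m a c (- t i)) \<in> borel_measurable Mm" if "i < n" for i
      proof -
        have "(\<lambda>c. \<phi> (a, b, c) (- t i)) \<in> borel_measurable Mm"
          by (rule measurable_compose[OF _ measurable_network]) (use a b in measurable)
        then show ?thesis
          by (subst measurable_cong[where g = "\<lambda>c. \<phi> (a, b, c) (- t i)"])
            (use a b t that in \<open>auto simp: split_neg\<close>)
      qed
      have "(\<lambda>c. \<lambda>i\<in>{..<n}. \<phi>m a c (- t i)) \<in> measurable Mm (\<Pi>\<^sub>M i\<in>{..<n}. borel)"
        by (rule measurable_restrict) simp
      note [measurable] = measurable_compose[OF this F_meas]
      have [measurable]: "Pm a \<in> borel_measurable Mm"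
        using measurable_compose[OF measurable_Pair1'[OF a] Pm_measurable] by simp
      have "(\<lambda>c. cnj (F (\<lambda>i\<in>{..<n}. \<phi>m a c (- t i)))) \<in> borel_measurable Mm"
        by (rule borel_measurable_continuous_on[OF continuous_on_cnj[OF continuous_on_id]]) measurable
      then show ?thesis unfolding H_def by measurable
    qed
    have H_integral: "(\<integral>c. H a c \<partial>Mm) = cnj (\<integral>b. G a b \<partial>Mp)" if a: "a \<in> space M0" for a
    proof -
      have "(\<integral>c. H a c \<partial>Mm) = (\<integral>c. H a c \<partial>distr Mp Mm \<sigma>)" by (simp only: \<sigma>_measure)
      also have "\<dots> = (\<integral>b. H a (\<sigma> b) \<partial>Mp)"
        by (rule integral_distr[OF \<sigma>_measurable H_meas[OF a]])
      also have "\<dots> = (\<integral>b. cnj (G a b) \<partial>Mp)"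
      proof (rule Bochner_Integration.integral_cong[OF refl])
        fix b assume b: "b \<in> space Mp"
        \<comment> \<open>Absorption turns the network at the reflected times into the network at
          the original ones; the density factor is real, so conjugation leaves it unchanged.\<close>
        have "(\<lambda>i\<in>{..<n}. \<phi>m a (\<sigma> b) (- t i)) = (\<lambda>i\<in>{..<n}. \<phi>p a b (t i))"
          using a b t by (auto simp: absorb_\<phi>p intro!: restrict_ext)
        then show "H a (\<sigma> b) = cnj (G a b)"
          using a b by (simp add: H_def G_def absorb_Pm)
      qed
      finally show ?thesis by simp
    qed
    \<comment> \<open>Integrability of the slice is a premise because Fubini supplies it only for
      almost every \<open>a\<close>.\<close>
    have slice: "(\<integral>y. R (a, y) \<partial>(Mp \<Otimes>\<^sub>M Mm)) \<in> \<real>\<^sub>\<ge>\<^sub>0"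
      if a: "a \<in> space M0" and int: "integrable (Mp \<Otimes>\<^sub>M Mm) (\<lambda>y. R (a, y))" for a
    proof -
      have eq: "R (a, y) = (case y of (b, c) \<Rightarrow> (complex_of_real (P0 a) * G a b) * H a c)"
        if "y \<in> space (Mp \<Otimes>\<^sub>M Mm)" for y
        using that a by (auto simp: space_pair_measure R_eq)
      \<comment> \<open>The constant \<open>P0 a\<close> is grouped with \<open>G a b\<close> to
        give a product of a function of \<open>b\<close> and a function of \<open>c\<close>.\<close>
      have "integrable (Mp \<Otimes>\<^sub>M Mm) (\<lambda>(b, c). (complex_of_real (P0 a) * G a b) * H a c)"
        using int by (simp cong: Bochner_Integration.integrable_cong add: eq)
      from pm.integral_product[OF this]
      have "(\<integral>y. R (a, y) \<partial>(Mp \<Otimes>\<^sub>M Mm))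
          = (\<integral>b. complex_of_real (P0 a) * G a b \<partial>Mp) * (\<integral>c. H a c \<partial>Mm)"
        by (simp cong: Bochner_Integration.integral_cong add: eq)
      \<comment> \<open>With z the integral of \<open>G a\<close>, the second factor is
        \<open>cnj z\<close>, and \<open>z * cnj z\<close> is the squared modulus of z.\<close>
      also have "\<dots> = complex_of_real (P0 a * (cmod (\<integral>b. G a b \<partial>Mp))\<^sup>2)"
        by (simp add: H_integral[OF a] mult.assoc complex_norm_square[symmetric] del: integral_cnj)
      finally show ?thesis
        using P0_nonneg[OF a] by (simp only: nonneg_Reals_of_real_iff) simp
    qed
    have "AE a in M0. (\<integral>y. R (a, y) \<partial>(Mp \<Otimes>\<^sub>M Mm)) \<in> \<real>\<^sub>\<ge>\<^sub>0"
      using all.AE_integrable_fst'[OF R_int] AE_space by eventually_elim (rule slice)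
    then have "(\<integral>a. \<integral>y. R (a, y) \<partial>(Mp \<Otimes>\<^sub>M Mm) \<partial>M0) \<in> \<real>\<^sub>\<ge>\<^sub>0"
      by (rule integral_nonneg_Reals_AE)
    then show ?thesis
      using all.integral_fst'[OF R_int] by (simp add: R_def)
  qed
  then show ?thesis by (auto simp: reflection_positive_def)
qed

end
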